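(* Let $n\ge 2$ and let $s,y\in\mathbb{R}^n$ satisfy $s^\top y>0$. For $\theta>0$ consider the symmetric positive definite matrix $$\hat Q(\theta)=\theta I-\theta\frac{yy^\top}{y^\top y}+\frac{ss^\top}{s^\top y},$$ which has $\theta$ as an eigenvalue $n-2$ times together with two remaining eigenvalues $0<\hat\lambda^-(\theta)\le\hat\lambda^+(\theta)$. Let $\mathrm{HM}(\theta),\mathrm{GM}(\theta),\mathrm{AM}(\theta),\mathrm{QM}(\theta)$ be the harmonic, geometric, arithmetic and quadratic means of $\hat\lambda^-(\theta),\hat\lambda^+(\theta)$. Then $$\theta^\star:=\frac{\|s\|^2}{s^\top y}$$ is the minimizer over $\theta>0$ of each of the six functions $$\frac{\mathrm{AM}(\theta)}{\mathrm{GM}(\theta)},\quad \frac{\mathrm{GM}(\theta)}{\mathrm{HM}(\theta)},\quad \frac{\mathrm{AM}(\theta)}{\mathrm{HM}(\theta)},\quad \frac{\mathrm{QM}(\theta)}{\mathrm{AM}(\theta)},\quad \frac{\mathrm{QM}(\theta)}{\mathrm{GM}(\theta)},\quad \frac{\mathrm{QM}(\theta)}{\mathrm{HM}(\theta)}.$$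
   Context: $\|\cdot\|$ is the Euclidean norm. For positive numbers $a_1,a_2$: $\mathrm{HM}=2/(1/a_1+1/a_2)$, $\mathrm{GM}=\sqrt{a_1a_2}$, $\mathrm{AM}=(a_1+a_2)/2$, $\mathrm{QM}=\sqrt{(a_1^2+a_2^2)/2}$. Here $s=x_{k+1}-x_k$ and $y=\nabla f(x_{k+1})-\nabla f(x_k)$; the Wolfe line search guarantees $s^\top y>0$. The matrix $\hat Q(\theta)$ is the scaled memoryless DFP matrix. The two remaining eigenvalues are those left after removing $n-2$ copies of $\theta$ from the spectrum counted with multiplicity. *)

theory Defs
  imports "HOL-Analysis.Analysis" "HOL-Computational_Algebra.Computational_Algebra"
begin

definition outer_prod :: "real^'n \<Rightarrow> real^'n \<Rightarrow> real^'n^'n" where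
  "outer_prod u v = (\<chi> i j. u $ i * v $ j)"

definition sym_pos_def :: "real^'n^'n \<Rightarrow> bool" where
  "sym_pos_def A \<longleftrightarrow> transpose A = A \<and> (\<forall>v. v \<noteq> 0 \<longrightarrow> 0 < v \<bullet> (A *v v))"

definition charpoly :: "real^'n^'n \<Rightarrow> real poly" where
  "charpoly A = det (mat [:0, 1:] - (\<chi> i j. [:A $ i $ j:]))"

text \<open>Only real eigenvalues are collected, with algebraic multiplicity; for a symmetric
  matrix these are all the eigenvalues.\<close>

definition spectrum_mset :: "real^'n^'n \<Rightarrow> real multiset" where
  "spectrum_mset A = proots (charpoly A)"

definition Q_hat :: "real^'n \<Rightarrow> real^'n \<Rightarrow> real \<Rightarrow> real^'n^'n" where
  "Q_hat s y \<theta> = \<theta> *\<^sub>R mat 1 - \<theta> *\<^sub>R ((1 / (y \<bullet> y)) *\<^sub>R outer_prod y y)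
     + (1 / (s \<bullet> y)) *\<^sub>R outer_prod s s"

definition remaining_eigenvalues :: "real^'n \<Rightarrow> real^'n \<Rightarrow> real \<Rightarrow> real multiset" where
  "remaining_eigenvalues s y \<theta> = spectrum_mset (Q_hat s y \<theta>) - replicate_mset (CARD('n) - 2) \<theta>"

definition lambda_minus :: "real^'n \<Rightarrow> real^'n \<Rightarrow> real \<Rightarrow> real" where
  "lambda_minus s y \<theta> = Min (set_mset (remaining_eigenvalues s y \<theta>))"

definition lambda_plus :: "real^'n \<Rightarrow> real^'n \<Rightarrow> real \<Rightarrow> real" where
  "lambda_plus s y \<theta> = Max (set_mset (remaining_eigenvalues s y \<theta>))"

definition harmonic_mean :: "real \<Rightarrow> real \<Rightarrow> real" where
  "harmonic_mean a b = 2 / (1 / a + 1 / b)"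

definition geometric_mean :: "real \<Rightarrow> real \<Rightarrow> real" where
  "geometric_mean a b = sqrt (a * b)"

definition arithmetic_mean :: "real \<Rightarrow> real \<Rightarrow> real" where
  "arithmetic_mean a b = (a + b) / 2"

definition quadratic_mean :: "real \<Rightarrow> real \<Rightarrow> real" where
  "quadratic_mean a b = sqrt ((a\<^sup>2 + b\<^sup>2) / 2)"

definition HM :: "real^'n \<Rightarrow> real^'n \<Rightarrow> real \<Rightarrow> real" where
  "HM s y \<theta> = harmonic_mean (lambda_minus s y \<theta>) (lambda_plus s y \<theta>)"

definition GM :: "real^'n \<Rightarrow> real^'n \<Rightarrow> real \<Rightarrow> real" where
  "GM s y \<theta> = geometric_mean (lambda_minus s y \<theta>) (lambda_plus s y \<theta>)"

definition AM :: "real^'n \<Rightarrow> real^'n \<Rightarrow> real \<Rightarrow> real" where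
  "AM s y \<theta> = arithmetic_mean (lambda_minus s y \<theta>) (lambda_plus s y \<theta>)"

definition QM :: "real^'n \<Rightarrow> real^'n \<Rightarrow> real \<Rightarrow> real" where
  "QM s y \<theta> = quadratic_mean (lambda_minus s y \<theta>) (lambda_plus s y \<theta>)"

definition theta_star :: "real^'n \<Rightarrow> real^'n \<Rightarrow> real" where
  "theta_star s y = (norm s)\<^sup>2 / (s \<bullet> y)"

text \<open>``The'' minimizer is read as: a minimizer, and the only one.\<close>

definition is_the_minimizer_pos :: "(real \<Rightarrow> real) \<Rightarrow> real \<Rightarrow> bool" where
  "is_the_minimizer_pos F t \<longleftrightarrow> (\<forall>\<theta>. is_arg_min F (\<lambda>\<theta>. 0 < \<theta>) \<theta> \<longleftrightarrow> \<theta> = t)"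

end

theory Submission
  imports Defs
begin

text \<open>The two remaining eigenvalues have sum \<open>S = \<theta> + \<theta>\<^sup>\<star>\<close> and product \<open>P = \<theta> (s \<bullet> y) / (y \<bullet> y)\<close>:
  at all but finitely many points the characteristic polynomial is computed by writing
  \<open>x I - Q\<close> as a multiple of a product of two rank-one perturbations of the identity.
  Each of the six quotients of means is a strictly increasing function of \<open>S\<^sup>2 / P\<close>, and
  \<open>S\<^sup>2 / P\<close> exceeds its value at \<open>\<theta>\<^sup>\<star>\<close> by \<open>(\<theta> - \<theta>\<^sup>\<star>)\<^sup>2 / P\<close>.\<close>

section \<open>Rank-one matrices and the determinant of a rank-one perturbation of the
  identity\<close>

lemma outer_prod_mult_vec: "outer_prod u v *v w = (v \<bullet> w) *\<^sub>R u"
  by (simp add: vec_eq_iff outer_prod_def matrix_vector_mult_def inner_vec_def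
      sum_distrib_right sum_distrib_left mult_ac)

lemma matrix_mult_outer_prod: "A ** outer_prod u v = outer_prod (A *v u) v"
  by (simp add: vec_eq_iff outer_prod_def matrix_vector_mult_def matrix_matrix_mult_def
      sum_distrib_right sum_distrib_left mult_ac)

lemma outer_prod_mult_matrix: "outer_prod u v ** A = outer_prod u (transpose A *v v)"
  by (simp add: vec_eq_iff outer_prod_def matrix_vector_mult_def matrix_matrix_mult_def
      transpose_def sum_distrib_right sum_distrib_left mult_ac)

lemma matrix_add_rdistrib: "(A + B) ** C = A ** C + B ** C"
  by (simp add: vec_eq_iff matrix_matrix_mult_def distrib_right sum.distrib)

lemma det_scaleR:
  fixes A :: "real^'n^'n"
  shows "det (c *\<^sub>R A) = c ^ CARD('n) * det A"
proof -
  have "c *\<^sub>R A = (\<chi> i. c *s A $ i)"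
    by (simp add: vec_eq_iff)
  then show ?thesis
    using det_rows_mul[of "\<lambda>_. c" "\<lambda>i. A $ i"] by simp
qed

lemma det_mat_1_plus_outer_prod:
  fixes u v :: "real^'n"
  shows "det (mat 1 + outer_prod u v) = 1 + u \<bullet> v"
proof (cases "v = 0")
  case True
  then have "outer_prod u v = 0"
    by (simp add: vec_eq_iff outer_prod_def)
  then show ?thesis
    using True by simp
next
  case False
  fix k :: 'n
  have "norm (v /\<^sub>R norm v) = 1"
    using False by simp
  \<comment> \<open>In an orthonormal basis whose \<open>k\<close>-th vector is \<open>v / \<bar>v\<bar>\<close> only the \<open>k\<close>-th column of the matrix
    differs from the identity.\<close>
  then obtain A where A: "orthogonal_matrix A" "A *v axis k 1 = v /\<^sub>R norm v"
    by (rule orthogonal_matrix_exists_basis)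
  define B where "B = transpose A"
  have BA: "B ** A = mat 1" and AB: "A ** B = mat 1"
    using A(1) by (simp_all add: orthogonal_matrix_def B_def)
  have "v = norm v *\<^sub>R (A *v axis k 1)"
    using False by (simp add: A(2))
  then have "B *v v = norm v *\<^sub>R (B *v (A *v axis k 1))"
    by (metis matrix_vector_mult_scaleR)
  then have Bv: "B *v v = norm v *\<^sub>R axis k 1"
    by (simp add: matrix_vector_mul_assoc BA)
  have "u \<bullet> v = (B *v u) \<bullet> (B *v v)"
    by (simp add: dot_lmul_matrix[symmetric] B_def matrix_vector_mul_assoc AB[unfolded B_def]
        flip: transpose_matrix_vector)
  then have uv: "u \<bullet> v = norm v * (B *v u) $ k"
    by (simp add: Bv inner_axis)
  define x where "x = axis k 1 + norm v *\<^sub>R (B *v u)"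
  have "det (mat 1 + outer_prod u v) = det (B ** A) * det (mat 1 + outer_prod u v)"
    by (simp add: BA)
  also have "\<dots> = det (B ** (mat 1 + outer_prod u v) ** A)"
    by (simp add: det_mul)
  also have "B ** (mat 1 + outer_prod u v) ** A = mat 1 + outer_prod (B *v u) (norm v *\<^sub>R axis k 1)"
    by (simp add: matrix_add_ldistrib matrix_add_rdistrib BA matrix_mult_outer_prod
        outer_prod_mult_matrix Bv flip: B_def)
  also have "\<dots> = (\<chi> i j. if j = k then x $ i else (mat 1 :: real^'n^'n) $ i $ j)"
    by (auto simp: vec_eq_iff outer_prod_def mat_def axis_def x_def)
  \<comment> \<open>\<open>cramer_lemma\<close> for the identity matrix evaluates the determinant to
    the replaced diagonal entry \<open>x $ k\<close>, which is \<open>1 + u \<bullet> v\<close> by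
    \<open>uv\<close>.\<close>
  also have "det \<dots> = 1 + u \<bullet> v"
    using cramer_lemma[of k "mat 1 :: real^'n^'n" x, unfolded matrix_vector_mul_lid]
    by (simp add: x_def uv)
  finally show ?thesis .
qed

section \<open>The characteristic polynomial of \<open>Q_hat\<close>\<close>

lemma poly_det: "poly (det M) x = det (\<chi> i j. poly (M $ i $ j) x)"
  by (simp add: det_def poly_sum poly_prod of_int_poly)

lemma poly_charpoly: "poly (charpoly A) x = det (x *\<^sub>R mat 1 - A)"
  unfolding charpoly_def poly_det
  by (rule arg_cong[of _ _ det]) (simp add: vec_eq_iff mat_def)

text \<open>In characteristic 0 the ring is infinite, so a nonzero difference \<open>p - q\<close>
  cannot vanish off a finite set. This permits dividing by \<open>x\<close> and
  \<open>x - \<theta>\<close> when \<open>charpoly\<close> is evaluated.\<close>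

lemma poly_eqI_cofinite:
  fixes p q :: "'a::{idom, ring_char_0} poly"
  assumes "finite S" "\<And>x. x \<notin> S \<Longrightarrow> poly p x = poly q x"
  shows "p = q"
proof (rule ccontr)
  assume "p \<noteq> q"
  then have "finite {x. poly (p - q) x = 0}"
    by (intro poly_roots_finite) simp
  moreover have "UNIV = S \<union> {x. poly (p - q) x = 0}"
    using assms(2) by auto
  ultimately have "finite (UNIV :: 'a set)"
    using assms(1) by (metis finite_UnI)
  then show False
    by (simp add: infinite_UNIV_char_0)
qed

lemma charpoly_Q_hat:
  fixes s y :: "real^'n"
  assumes "2 \<le> CARD('n)" and sy: "0 < s \<bullet> y"
  shows "charpoly (Q_hat s y \<theta>) =
    [:-\<theta>, 1:] ^ (CARD('n) - 2) * [:\<theta> * ((s \<bullet> y) / (y \<bullet> y)), -(\<theta> + theta_star s y), 1:]"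
proof (rule poly_eqI_cofinite[where S = "{0, \<theta>}"])
  fix x assume "x \<notin> {0, \<theta>}"
  then have x: "x \<noteq> 0" "x - \<theta> \<noteq> 0" by auto
  have yy: "y \<bullet> y \<noteq> 0"
    using sy by auto
  define u where "u = x - \<theta>"
  define c where "c = \<theta> / ((y \<bullet> y) * u)"
  \<comment> \<open>With \<open>M = mat 1 + outer_prod (c *\<^sub>R y) y\<close>, the matrix
    \<open>x I - Q\<close> divided by \<open>u\<close> is M minus
    \<open>ss\<^sup>T / ((s \<bullet> y) u)\<close>. Taking out M on the left leaves a rank-one
    perturbation with left vector \<open>w\<close>, the solution of
    \<open>M w = - s / ((s \<bullet> y) u)\<close>; Sherman-Morrison gives the formula for
    \<open>w\<close>.\<close>
  define w where "w = (- 1 / ((s \<bullet> y) * u)) *\<^sub>R (s - (\<theta> * (s \<bullet> y) / ((y \<bullet> y) * x)) *\<^sub>R y)"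
  have u: "u \<noteq> 0" "x = u + \<theta>"
    using x by (auto simp: u_def)
  have sw: "s \<bullet> w = (- 1 / ((s \<bullet> y) * u)) * (s \<bullet> s - (\<theta> * (s \<bullet> y) / ((y \<bullet> y) * x)) * (s \<bullet> y))"
    by (simp add: w_def inner_diff_right)
  have Mw: "(mat 1 + outer_prod (c *\<^sub>R y) y) *v w = (- 1 / ((s \<bullet> y) * u)) *\<^sub>R s"
  proof -
    \<comment> \<open>The coefficient d of \<open>y\<close> is a fixed point of
      \<open>d \<mapsto> c (s \<bullet> y - d (y \<bullet> y))\<close>, so the \<open>y\<close>
      terms of the product cancel and only a multiple of \<open>s\<close> remains.\<close>
    have coef: "c * (s \<bullet> y - (\<theta> * (s \<bullet> y) / ((y \<bullet> y) * x)) * (y \<bullet> y)) = \<theta> * (s \<bullet> y) / ((y \<bullet> y) * x)"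
    proof -
      have "\<theta> * (s \<bullet> y) / ((y \<bullet> y) * x) * (y \<bullet> y) = \<theta> * (s \<bullet> y) / x"
        using yy by simp
      moreover have "s \<bullet> y - \<theta> * (s \<bullet> y) / x = u * (s \<bullet> y) / x"
        using x by (simp add: u_def field_simps)
      ultimately show ?thesis
        using u(1) by (simp add: c_def)
    qed
    have "(mat 1 + outer_prod (c *\<^sub>R y) y) *v (s - d *\<^sub>R y)
        = s - d *\<^sub>R y + (c * (s \<bullet> y - d * (y \<bullet> y))) *\<^sub>R y" for d
      by (simp add: matrix_vector_mult_add_rdistrib outer_prod_mult_vec inner_diff_right
          inner_commute mult_ac)
    note this[of "\<theta> * (s \<bullet> y) / ((y \<bullet> y) * x)", unfolded coef]
    then show ?thesis
      unfolding w_def matrix_vector_mult_scaleR by simp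
  qed
  have "x *\<^sub>R mat 1 - Q_hat s y \<theta> =
      u *\<^sub>R ((mat 1 + outer_prod (c *\<^sub>R y) y) ** (mat 1 + outer_prod w s))"
    unfolding matrix_add_ldistrib matrix_mult_outer_prod matrix_mul_rid Mw
    using u yy sy by (simp add: vec_eq_iff Q_hat_def outer_prod_def mat_def c_def field_simps)
  then have "poly (charpoly (Q_hat s y \<theta>)) x = u ^ CARD('n) * ((1 + c * (y \<bullet> y)) * (1 + s \<bullet> w))"
    by (simp add: poly_charpoly det_scaleR det_mul det_mat_1_plus_outer_prod inner_commute)
  \<comment> \<open>Two of the factors \<open>u\<close> clear the denominators of the two rank-one
    determinants and produce the quadratic factor; the others form the power belonging to the
    eigenvalue \<theta>. The split uses n >= 2.\<close>
  also have "u ^ CARD('n) = u ^ (CARD('n) - 2) * u\<^sup>2"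
    using assms(1) by (metis le_add_diff_inverse2 power_add)
  also have "\<dots> * ((1 + c * (y \<bullet> y)) * (1 + s \<bullet> w))
      = u ^ (CARD('n) - 2) * (u\<^sup>2 * ((1 + c * (y \<bullet> y)) * (1 + s \<bullet> w)))"
    by simp
  also have "u\<^sup>2 * ((1 + c * (y \<bullet> y)) * (1 + s \<bullet> w))
      = x * u - x * theta_star s y + \<theta> * ((s \<bullet> y) / (y \<bullet> y))"
  proof -
    have quad: "u\<^sup>2 * (x / u * (1 - (\<sigma> - P / x) / u)) = x * u - x * \<sigma> + P" for \<sigma> P
      using u(1) x(1) by (simp add: power2_eq_square field_simps)
    have "1 + c * (y \<bullet> y) = x / u"
      using u yy by (simp add: c_def field_simps)
    moreover have "1 + s \<bullet> w = 1 - (theta_star s y - \<theta> * ((s \<bullet> y) / (y \<bullet> y)) / x) / u"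
      using u x yy sy by (simp add: sw theta_star_def power2_norm_eq_inner field_simps)
    ultimately have "u\<^sup>2 * ((1 + c * (y \<bullet> y)) * (1 + s \<bullet> w))
      = u\<^sup>2 * (x / u * (1 - (theta_star s y - \<theta> * ((s \<bullet> y) / (y \<bullet> y)) / x) / u))"
      by (simp only:)
    also have "\<dots> = x * u - x * theta_star s y + \<theta> * ((s \<bullet> y) / (y \<bullet> y))"
      by (rule quad)
    finally show ?thesis .
  qed
  finally show "poly (charpoly (Q_hat s y \<theta>)) x = poly ([:-\<theta>, 1:] ^ (CARD('n) - 2) *
      [:\<theta> * ((s \<bullet> y) / (y \<bullet> y)), -(\<theta> + theta_star s y), 1:]) x"
    by (simp add: u_def algebra_simps)
qed simp

section \<open>The two remaining eigenvalues\<close>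

lemma theta_star_pos: "0 < s \<bullet> y \<Longrightarrow> 0 < theta_star s y"
  by (cases "s = 0") (auto simp: theta_star_def)

text \<open>Cauchy-Schwarz with denominators cleared; the two sides are the two Barzilai-Borwein
  step sizes. It makes the discriminant below nonnegative, so that both remaining eigenvalues are
  real.\<close>

lemma theta_star_ge: "0 < s \<bullet> y \<Longrightarrow> (s \<bullet> y) / (y \<bullet> y) \<le> theta_star s y"
proof -
  assume sy: "0 < s \<bullet> y"
  then have "0 < y \<bullet> y"
    by auto
  moreover have "(s \<bullet> y) * (s \<bullet> y) \<le> (s \<bullet> s) * (y \<bullet> y)"
    using Cauchy_Schwarz_ineq[of s y] by (simp add: power2_eq_square)
  ultimately show ?thesis
    using sy by (simp add: theta_star_def power2_norm_eq_inner divide_le_eq le_divide_eq mult_ac)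
qed

lemma remaining_eigenvalues_Q_hat:
  fixes s y :: "real^'n"
  assumes "2 \<le> CARD('n)" and sy: "0 < s \<bullet> y" and th: "0 < \<theta>"
  defines "a \<equiv> lambda_minus s y \<theta>" and "b \<equiv> lambda_plus s y \<theta>"
  shows "0 < a" "a \<le> b" "a + b = \<theta> + theta_star s y" "a * b = \<theta> * ((s \<bullet> y) / (y \<bullet> y))"
    "spectrum_mset (Q_hat s y \<theta>) = replicate_mset (CARD('n) - 2) \<theta> + {#a, b#}"
proof -
  define S where "S = \<theta> + theta_star s y"
  define P where "P = \<theta> * ((s \<bullet> y) / (y \<bullet> y))"
  \<comment> \<open>\<open>p\<close> and \<open>q\<close> are the roots of the quadratic factor
    \<open>t\<^sup>2 - S t + P\<close>.\<close>
  define p where "p = (S - sqrt (S\<^sup>2 - 4 * P)) / 2"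
  define q where "q = (S + sqrt (S\<^sup>2 - 4 * P)) / 2"
  have "y \<noteq> 0"
    using sy by auto
  then have P: "0 < P"
    using sy th by (simp add: P_def)
  have S: "0 < S"
    using th theta_star_pos[OF sy] by (simp add: S_def)
  \<comment> \<open>Replacing \<open>P\<close> by this upper bound turns the discriminant into a
    perfect square.\<close>
  have "P \<le> \<theta> * theta_star s y"
    unfolding P_def using theta_star_ge[OF sy] th by (intro mult_left_mono) auto
  moreover have "S\<^sup>2 - 4 * (\<theta> * theta_star s y) = (\<theta> - theta_star s y)\<^sup>2"
    by (simp add: S_def power2_eq_square algebra_simps)
  ultimately have disc: "0 \<le> S\<^sup>2 - 4 * P"
    using zero_le_power2[of "\<theta> - theta_star s y"] by linarith
  have pq: "p + q = S"
    by (simp add: p_def q_def field_simps)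
  have "p * q = (S\<^sup>2 - (sqrt (S\<^sup>2 - 4 * P))\<^sup>2) / 4"
    by (simp add: p_def q_def power2_eq_square algebra_simps)
  then have pq': "p * q = P"
    using disc by simp
  have le: "p \<le> q"
    using disc by (simp add: p_def q_def)
  then have "0 < q"
    using pq S by linarith
  then have "0 < p"
    using pq' P by (metis zero_less_mult_pos2)
  have "[:P, -S, 1:] = [:-p, 1:] * [:-q, 1:]"
    by (simp add: mult.commute flip: pq pq')
  then have spec: "spectrum_mset (Q_hat s y \<theta>) = replicate_mset (CARD('n) - 2) \<theta> + {#p, q#}"
    unfolding spectrum_mset_def charpoly_Q_hat[OF assms(1) sy] S_def[symmetric] P_def[symmetric]
    by (simp add: proots_mult proots_power del: mult_pCons_left mult_pCons_right)
  \<comment> \<open>Multiset difference removes exactly n - 2 copies of \<theta>, so this stays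
    correct when \<open>p\<close> or \<open>q\<close> equals \<theta>.\<close>
  then have "remaining_eigenvalues s y \<theta> = {#p, q#}"
    by (simp add: remaining_eigenvalues_def)
  then have "a = p" "b = q"
    using le by (simp_all add: a_def b_def lambda_minus_def lambda_plus_def)
  then show "0 < a" "a \<le> b" "a + b = \<theta> + theta_star s y" "a * b = \<theta> * ((s \<bullet> y) / (y \<bullet> y))"
    "spectrum_mset (Q_hat s y \<theta>) = replicate_mset (CARD('n) - 2) \<theta> + {#a, b#}"
    using \<open>0 < p\<close> le pq pq' spec by (simp_all add: S_def P_def)
qed

section \<open>Positive definiteness\<close>

lemma sym_pos_def_Q_hat:
  assumes sy: "0 < s \<bullet> y" and th: "0 < \<theta>"
  shows "sym_pos_def (Q_hat s y \<theta>)"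
  unfolding sym_pos_def_def
proof (intro conjI allI impI)
  show "transpose (Q_hat s y \<theta>) = Q_hat s y \<theta>"
    by (auto simp: vec_eq_iff transpose_def Q_hat_def outer_prod_def mat_def mult_ac)
  fix v :: "real^'a" assume "v \<noteq> 0"
  have yy: "y \<bullet> y \<noteq> 0"
    using sy by auto
  \<comment> \<open>\<open>w\<close> is the component of \<open>v\<close> orthogonal to
    \<open>y\<close>; the first two terms of \<open>Q_hat\<close> contribute
    \<open>\<theta> * (w \<bullet> w)\<close> to the quadratic form.\<close>
  define w where "w = v - ((y \<bullet> v) / (y \<bullet> y)) *\<^sub>R y"
  have ww: "w \<bullet> w = v \<bullet> v - (y \<bullet> v)\<^sup>2 / (y \<bullet> y)"
    using yy by (simp add: w_def inner_diff_left inner_diff_right inner_commute power2_eq_square field_simps)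
  have "v \<bullet> (Q_hat s y \<theta> *v v) = \<theta> * (v \<bullet> v) - \<theta> * ((y \<bullet> v)\<^sup>2 / (y \<bullet> y)) + (s \<bullet> v)\<^sup>2 / (s \<bullet> y)"
    by (simp add: Q_hat_def matrix_vector_mult_add_rdistrib matrix_vector_mult_diff_rdistrib
        outer_prod_mult_vec inner_diff_right inner_add_right inner_commute power2_eq_square
        flip: scaleR_matrix_vector_assoc)
  also have "\<dots> = \<theta> * (w \<bullet> w) + (s \<bullet> v)\<^sup>2 / (s \<bullet> y)"
    by (simp add: ww right_diff_distrib)
  finally have eq: "v \<bullet> (Q_hat s y \<theta> *v v) = \<theta> * (w \<bullet> w) + (s \<bullet> v)\<^sup>2 / (s \<bullet> y)" .
  show "0 < v \<bullet> (Q_hat s y \<theta> *v v)"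
  \<comment> \<open>If \<open>w\<close> vanishes, \<open>v\<close> is a nonzero multiple of
    \<open>y\<close>, and \<open>s \<bullet> y > 0\<close> makes the \<open>s\<close> term positive.
    Otherwise the \<open>w\<close> term is positive.\<close>
  proof (cases "w = 0")
    case True
    define d where "d = (y \<bullet> v) / (y \<bullet> y)"
    have v: "v = d *\<^sub>R y"
      using True by (simp add: w_def d_def)
    then have "d \<noteq> 0"
      using \<open>v \<noteq> 0\<close> by auto
    then have "s \<bullet> v \<noteq> 0"
      using v sy by simp
    then show ?thesis
      unfolding eq using True sy by simp
  next
    case False
    then have "0 < \<theta> * (w \<bullet> w)"
      using th by simp
    then show ?thesis
      unfolding eq using sy by (intro add_pos_nonneg) auto
  qed
qed

section \<open>Quotients of means as functions of \<open>(a + b)\<^sup>2 / (a * b)\<close>\<close>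

lemma mean_quotients:
  assumes a: "0 < a" and b: "0 < b"
  defines "r \<equiv> (a + b)\<^sup>2 / (a * b)"
  shows "4 \<le> r"
    and "arithmetic_mean a b / geometric_mean a b = sqrt r / 2"
    and "geometric_mean a b / harmonic_mean a b = sqrt r / 2"
    and "arithmetic_mean a b / harmonic_mean a b = r / 4"
    and "quadratic_mean a b / arithmetic_mean a b = sqrt (2 - 4 / r)"
    and "quadratic_mean a b / geometric_mean a b = sqrt (r / 2 - 1)"
    and "quadratic_mean a b / harmonic_mean a b = sqrt (r / 2 - 1) * (sqrt r / 2)"
proof -
  have "4 * (a * b) \<le> (a + b)\<^sup>2"
    using zero_le_power2[of "a - b"] by (simp add: power2_eq_square algebra_simps)
  then show "4 \<le> r"
    using a b by (simp add: r_def field_simps)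
  have AM: "arithmetic_mean a b = sqrt r / 2 * geometric_mean a b"
    using a b by (simp add: arithmetic_mean_def geometric_mean_def r_def real_sqrt_divide)
  have gm: "0 < geometric_mean a b" "(geometric_mean a b)\<^sup>2 = a * b"
    using a b by (simp_all add: geometric_mean_def)
  \<comment> \<open>The identity AM HM = \<open>GM\<^sup>2\<close> makes GM/HM equal to AM/GM. The
    quotients AM/HM, QM/HM and QM/AM then follow from AM/GM and QM/GM.\<close>
  have "arithmetic_mean a b * harmonic_mean a b = (geometric_mean a b)\<^sup>2"
    using a b unfolding gm by (simp add: arithmetic_mean_def harmonic_mean_def field_simps)
  moreover have am: "0 < arithmetic_mean a b" and hm: "0 < harmonic_mean a b"
    using a b by (simp_all add: arithmetic_mean_def harmonic_mean_def add_pos_pos)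
  ultimately have GH: "geometric_mean a b / harmonic_mean a b = arithmetic_mean a b / geometric_mean a b"
    using gm(1) by (simp add: field_simps power2_eq_square)
  show 1: "arithmetic_mean a b / geometric_mean a b = sqrt r / 2"
    using AM gm by simp
  then show 2: "geometric_mean a b / harmonic_mean a b = sqrt r / 2"
    by (simp add: GH)
  have r: "0 < r"
    using \<open>4 \<le> r\<close> by simp
  have "arithmetic_mean a b / harmonic_mean a b =
    (arithmetic_mean a b / geometric_mean a b) * (geometric_mean a b / harmonic_mean a b)"
    using gm by simp
  then show "arithmetic_mean a b / harmonic_mean a b = r / 4"
    using r unfolding 1 2 by simp
  \<comment> \<open>This is \<open>a\<^sup>2 + b\<^sup>2 = (a + b)\<^sup>2 - 2 a b\<close>, with the
    square written as \<open>r * (a * b)\<close>.\<close>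
  have q: "(a\<^sup>2 + b\<^sup>2) / 2 = (r / 2 - 1) * (a * b)"
    using a b by (simp add: r_def field_simps power2_eq_square)
  show 3: "quadratic_mean a b / geometric_mean a b = sqrt (r / 2 - 1)"
    using a b unfolding quadratic_mean_def q by (simp add: geometric_mean_def real_sqrt_mult)
  have "quadratic_mean a b / harmonic_mean a b =
    (quadratic_mean a b / geometric_mean a b) * (geometric_mean a b / harmonic_mean a b)"
    using gm by simp
  then show "quadratic_mean a b / harmonic_mean a b = sqrt (r / 2 - 1) * (sqrt r / 2)"
    unfolding 3 2 .
  have "quadratic_mean a b / arithmetic_mean a b =
    (quadratic_mean a b / geometric_mean a b) / (arithmetic_mean a b / geometric_mean a b)"
    using gm by simp
  also have "\<dots> = sqrt (r / 2 - 1) / sqrt (r / 4)"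
    unfolding 3 1 by (simp add: real_sqrt_divide)
  also have "\<dots> = sqrt ((r / 2 - 1) / (r / 4))"
    by (simp only: real_sqrt_divide)
  also have "(r / 2 - 1) / (r / 4) = 2 - 4 / r"
    using r by (simp add: field_simps)
  finally show "quadratic_mean a b / arithmetic_mean a b = sqrt (2 - 4 / r)" .
qed

section \<open>Unique minimizers and their transfer along increasing functions\<close>

lemma is_the_minimizer_posI:
  assumes "0 < t" "\<And>\<theta>. 0 < \<theta> \<Longrightarrow> \<theta> \<noteq> t \<Longrightarrow> F t < F \<theta>"
  shows "is_the_minimizer_pos F t"
  unfolding is_the_minimizer_pos_def is_arg_min_def
  using assms by (metis less_asym less_irrefl)

text \<open>A strictly increasing \<open>g\<close> both preserves and reflects \<open><\<close> on
  \<open>A\<close>, so \<open>F\<close> and \<open>r\<close> have the same minimizers; existence and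
  uniqueness carry over together.\<close>

lemma is_the_minimizer_pos_strict_mono_on:
  fixes g r F :: "real \<Rightarrow> real"
  assumes "is_the_minimizer_pos r t" "strict_mono_on A g"
    and "\<And>\<theta>. 0 < \<theta> \<Longrightarrow> r \<theta> \<in> A" "\<And>\<theta>. 0 < \<theta> \<Longrightarrow> F \<theta> = g (r \<theta>)"
  shows "is_the_minimizer_pos F t"
proof -
  have *: "is_arg_min F (\<lambda>\<theta>. 0 < \<theta>) \<theta> = is_arg_min r (\<lambda>\<theta>. 0 < \<theta>) \<theta>" for \<theta>
    unfolding is_arg_min_def using assms(3,4) strict_mono_on_less[OF assms(2)] by metis
  show ?thesis
    using assms(1) by (simp add: is_the_minimizer_pos_def *)
qed

lemma is_the_minimizer_pos_sum_squared_over_product: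
  assumes "0 < \<sigma>" "0 < \<tau>"
  shows "is_the_minimizer_pos (\<lambda>\<theta>. (\<theta> + \<sigma>)\<^sup>2 / (\<theta> * \<tau>)) \<sigma>"
proof (rule is_the_minimizer_posI)
  fix \<theta> :: real assume th: "0 < \<theta>" "\<theta> \<noteq> \<sigma>"
  \<comment> \<open>Since \<open>(\<theta> + \<sigma>)\<^sup>2 = 4 \<theta> \<sigma> + (\<theta> -
    \<sigma>)\<^sup>2\<close>, the quotient is the constant \<open>4 \<sigma> / \<tau>\<close>, its
    value at \<sigma>, plus a term that is positive away from \<sigma>.\<close>
  have "(\<theta> + \<sigma>)\<^sup>2 / (\<theta> * \<tau>) - (\<sigma> + \<sigma>)\<^sup>2 / (\<sigma> * \<tau>) = (\<theta> - \<sigma>)\<^sup>2 / (\<theta> * \<tau>)"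
    using th assms by (simp add: field_simps power2_eq_square)
  moreover have "0 < (\<theta> - \<sigma>)\<^sup>2 / (\<theta> * \<tau>)"
    using th assms by simp
  ultimately show "(\<sigma> + \<sigma>)\<^sup>2 / (\<sigma> * \<tau>) < (\<theta> + \<sigma>)\<^sup>2 / (\<theta> * \<tau>)"
    by linarith
qed (fact assms)

theorem mainTheorem4:
  fixes s y :: "real^'n"
  assumes "2 \<le> CARD('n)" and "0 < s \<bullet> y"
  shows "(\<forall>\<theta>>0. sym_pos_def (Q_hat s y \<theta>)
            \<and> spectrum_mset (Q_hat s y \<theta>)
                = replicate_mset (CARD('n) - 2) \<theta> + {#lambda_minus s y \<theta>, lambda_plus s y \<theta>#}
            \<and> 0 < lambda_minus s y \<theta> \<and> lambda_minus s y \<theta> \<le> lambda_plus s y \<theta>)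
    \<and> is_the_minimizer_pos (\<lambda>\<theta>. AM s y \<theta> / GM s y \<theta>) (theta_star s y)
    \<and> is_the_minimizer_pos (\<lambda>\<theta>. GM s y \<theta> / HM s y \<theta>) (theta_star s y)
    \<and> is_the_minimizer_pos (\<lambda>\<theta>. AM s y \<theta> / HM s y \<theta>) (theta_star s y)
    \<and> is_the_minimizer_pos (\<lambda>\<theta>. QM s y \<theta> / AM s y \<theta>) (theta_star s y)
    \<and> is_the_minimizer_pos (\<lambda>\<theta>. QM s y \<theta> / GM s y \<theta>) (theta_star s y)
    \<and> is_the_minimizer_pos (\<lambda>\<theta>. QM s y \<theta> / HM s y \<theta>) (theta_star s y)"
proof -
  note ev = remaining_eigenvalues_Q_hat[OF assms]
  define \<tau> where "\<tau> = (s \<bullet> y) / (y \<bullet> y)"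
  define r where "r \<theta> = (\<theta> + theta_star s y)\<^sup>2 / (\<theta> * \<tau>)" for \<theta>
  have "y \<noteq> 0"
    using assms(2) by auto
  then have "0 < \<tau>"
    using assms(2) by (simp add: \<tau>_def)
  then have min_r: "is_the_minimizer_pos r (theta_star s y)"
    unfolding r_def using theta_star_pos[OF assms(2)]
    by (intro is_the_minimizer_pos_sum_squared_over_product)
  have pos: "0 < lambda_minus s y \<theta>" "0 < lambda_plus s y \<theta>" if "0 < \<theta>" for \<theta>
    using ev(1,2)[OF that] by auto
  have r: "r \<theta> = (lambda_minus s y \<theta> + lambda_plus s y \<theta>)\<^sup>2 / (lambda_minus s y \<theta> * lambda_plus s y \<theta>)"
    if "0 < \<theta>" for \<theta>
    unfolding ev(3,4)[OF that] r_def \<tau>_def ..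
  have mq: "r \<theta> \<in> {4..}"
    "AM s y \<theta> / GM s y \<theta> = sqrt (r \<theta>) / 2"
    "GM s y \<theta> / HM s y \<theta> = sqrt (r \<theta>) / 2"
    "AM s y \<theta> / HM s y \<theta> = r \<theta> / 4"
    "QM s y \<theta> / AM s y \<theta> = sqrt (2 - 4 / r \<theta>)"
    "QM s y \<theta> / GM s y \<theta> = sqrt (r \<theta> / 2 - 1)"
    "QM s y \<theta> / HM s y \<theta> = sqrt (r \<theta> / 2 - 1) * (sqrt (r \<theta>) / 2)"
    if "0 < \<theta>" for \<theta>
    unfolding AM_def GM_def HM_def QM_def r[OF that] atLeast_iff
    by (rule mean_quotients[OF pos[OF that]])+
  note minI = is_the_minimizer_pos_strict_mono_on[OF min_r, where A = "{4..}"]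
  \<comment> \<open>The bound 4 comes from AM >= GM. On this ray \<open>2 - 4 / r\<close> and
    \<open>r / 2 - 1\<close> are at least 1, and the last function is a product of positive
    increasing factors.\<close>
  have "strict_mono_on {4..} (\<lambda>r::real. sqrt r / 2)"
    "strict_mono_on {4..} (\<lambda>r::real. r / 4)"
    "strict_mono_on {4..} (\<lambda>r::real. sqrt (2 - 4 / r))"
    "strict_mono_on {4..} (\<lambda>r::real. sqrt (r / 2 - 1))"
    "strict_mono_on {4..} (\<lambda>r::real. sqrt (r / 2 - 1) * (sqrt r / 2))"
    by (auto intro!: strict_mono_onI mult_strict_mono divide_strict_left_mono)
  note mono = this
  show ?thesis
  proof (intro conjI)
    show "is_the_minimizer_pos (\<lambda>\<theta>. AM s y \<theta> / GM s y \<theta>) (theta_star s y)"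
      by (rule minI[OF mono(1)]) (simp_all only: mq)
    show "is_the_minimizer_pos (\<lambda>\<theta>. GM s y \<theta> / HM s y \<theta>) (theta_star s y)"
      by (rule minI[OF mono(1)]) (simp_all only: mq)
    show "is_the_minimizer_pos (\<lambda>\<theta>. AM s y \<theta> / HM s y \<theta>) (theta_star s y)"
      by (rule minI[OF mono(2)]) (simp_all only: mq)
    show "is_the_minimizer_pos (\<lambda>\<theta>. QM s y \<theta> / AM s y \<theta>) (theta_star s y)"
      by (rule minI[OF mono(3)]) (simp_all only: mq)
    show "is_the_minimizer_pos (\<lambda>\<theta>. QM s y \<theta> / GM s y \<theta>) (theta_star s y)"
      by (rule minI[OF mono(4)]) (simp_all only: mq)
    show "is_the_minimizer_pos (\<lambda>\<theta>. QM s y \<theta> / HM s y \<theta>) (theta_star s y)"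
      by (rule minI[OF mono(5)]) (simp_all only: mq)
  qed (use sym_pos_def_Q_hat[OF assms(2)] ev(1,2,5) in blast)
qed

end
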